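(* For every integer $n\geqslant 1$, $$s_n=\frac{1}{3\,(1+2v_5(n)-s_{n-1})}.$$
   Context: $v_5(n)$ denotes the $5$-adic valuation of the positive integer $n$. Define triples of integers $N_n=(a_n;b_n;c_n)$ for every integer $n\geqslant 1$ as the labels of the vertices of a quinary tree $\mathcal{A}_5$ read from the top and, at each level, from left to right. The top is $N_1=(1;3;0)$. For every $n\geqslant 1$, the first, second, third, fourth and fifth children of $N_n=(a;b;c)$ are respectively $N_{5n-3}$, $N_{5n-2}$, $N_{5n-1}$, $N_{5n}$, $N_{5n+1}$, and they are given by: - if $3\nmid b$: $N_{5n-3}=(3(4c+3)a-2b;\,3(6c+5)a-3b;\,0)$, $N_{5n-2}=((6c+5)a-b;\,6(c+1)a-b;\,0)$, $N_{5n-1}=(6(c+1)a-b;\,3a;\,0)$, $N_{5n}=(a;\,3a+b;\,c+1)$, $N_{5n+1}=(3a+b;\,6a+3b;\,0)$; - if $3\mid b$: $N_{5n-3}=((4c+3)a-\frac{2b}{3};\,(6c+5)a-b;\,0)$, $N_{5n-2}=((6c+5)a-b;\,6(c+1)a-b;\,0)$, $N_{5n-1}=(2(c+1)a-\frac{b}{3};\,a;\,0)$, $N_{5n}=(a;\,3a+b;\,c+1)$, $N_{5n+1}=(a+\frac{b}{3};\,2a+b;\,0)$. The sequence $(s_n)_{n\geqslant 0}$ is defined by $s_0=0$ and $s_n=\frac{a_n}{b_n}$ for every $n\geqslant 1$. *)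

theory Defs
  imports Complex_Main "HOL-Computational_Algebra.Primes"
begin

(* child i N, for i = 0, ..., 4, is the (i+1)-st child of N, counted from the left.
   In the second case 3 dvd b, so every b div 3 is an exact quotient. *)
fun child :: "nat \<Rightarrow> int \<times> int \<times> int \<Rightarrow> int \<times> int \<times> int" where
  "child i (a, b, c) =
    (if \<not> 3 dvd b then
       (if i = 0 then (3 * (4*c + 3) * a - 2*b, 3 * (6*c + 5) * a - 3*b, 0)
        else if i = 1 then ((6*c + 5) * a - b, 6 * (c + 1) * a - b, 0)
        else if i = 2 then (6 * (c + 1) * a - b, 3*a, 0)
        else if i = 3 then (a, 3*a + b, c + 1)
        else (3*a + b, 6*a + 3*b, 0))
     else
       (if i = 0 then ((4*c + 3) * a - 2 * (b div 3), (6*c + 5) * a - b, 0)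
        else if i = 1 then ((6*c + 5) * a - b, 6 * (c + 1) * a - b, 0)
        else if i = 2 then (2 * (c + 1) * a - b div 3, a, 0)
        else if i = 3 then (a, 3*a + b, c + 1)
        else (a + b div 3, 2*a + b, 0)))"

(* For n > 1, writing n = 5 * m - 3 + i with 0 <= i <= 4 gives
   m = (n + 3) div 5 and i = (n + 3) mod 5, see node_children below.
   The vertices are numbered from 1; the value at 0 is a dummy. *)
function node :: "nat \<Rightarrow> int \<times> int \<times> int" where
  "node n = (if n \<le> 1 then (1, 3, 0) else child ((n + 3) mod 5) (node ((n + 3) div 5)))"
  by auto
termination
  by (relation "measure id") auto

declare node.simps [simp del]

lemma node_1: "node 1 = (1, 3, 0)"
  by (simp add: node.simps)

lemma node_child:
  assumes "n \<ge> 1" "i \<le> 4"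
  shows "node (5 * n - 3 + i) = child i (node n)"
proof -
  have eq: "5 * n - 3 + i + 3 = i + 5 * n" using assms by simp
  have "\<not> 5 * n - 3 + i \<le> 1" using assms by linarith
  moreover have "(5 * n - 3 + i + 3) mod 5 = i" "(5 * n - 3 + i + 3) div 5 = n"
    unfolding eq using assms by simp_all
  ultimately show ?thesis
    by (subst node.simps) (simp only: if_False)
qed

lemma node_children:
  assumes "n \<ge> 1"
  shows "node (5 * n - 3) = child 0 (node n)"
    and "node (5 * n - 2) = child 1 (node n)"
    and "node (5 * n - 1) = child 2 (node n)"
    and "node (5 * n) = child 3 (node n)"
    and "node (5 * n + 1) = child 4 (node n)"
proof -
  have "5 * n - 3 + 1 = 5 * n - 2" "5 * n - 3 + 2 = 5 * n - 1"
       "5 * n - 3 + 3 = 5 * n" "5 * n - 3 + 4 = 5 * n + 1"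
    using assms by simp_all
  then show "node (5 * n - 3) = child 0 (node n)"
    and "node (5 * n - 2) = child 1 (node n)"
    and "node (5 * n - 1) = child 2 (node n)"
    and "node (5 * n) = child 3 (node n)"
    and "node (5 * n + 1) = child 4 (node n)"
    using node_child[OF assms, of 0] node_child[OF assms, of 1] node_child[OF assms, of 2]
      node_child[OF assms, of 3] node_child[OF assms, of 4]
    by simp_all
qed

definition node_a :: "nat \<Rightarrow> int" where
  "node_a n = fst (node n)"

definition node_b :: "nat \<Rightarrow> int" where
  "node_b n = fst (snd (node n))"

definition s :: "nat \<Rightarrow> rat" where
  "s n = (if n = 0 then 0 else of_int (node_a n) / of_int (node_b n))"

end

theory Submission
  imports Defs
begin

text \<open>
  The recurrence relates vertices with consecutive numbers, whereas the tree relates a vertex to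
  its parent. The two are reconciled as follows. Put \<open>t = s m\<close> and \<open>c = v\<^sub>5(m)\<close>; the third label of
  the vertex \<open>m\<close> is exactly \<open>c\<close>. Up to a common factor 3 of the first two labels, which cancels in
  the quotient, the children of \<open>m\<close> do not depend on whether 3 divides the second label, so their
  ratios are Moebius functions of \<open>t\<close> with coefficients that depend only on \<open>c\<close> (\<open>s_child\<close>). For the last four children, the recurrence
  is then an identity between such functions of \<open>t\<close>: the preceding vertex is a sibling, and the
  valuation is 0 except at the fourth child \<open>5m\<close>, where it is \<open>c + 1\<close>.

  The first child is different, because the vertex before it is the last child of \<open>m - 1\<close>. There the
  recurrence at \<open>m\<close> expresses \<open>s m\<close> through \<open>s (m - 1)\<close> and reduces the claim to an identity in
  \<open>s (m - 1)\<close>, so the theorem follows by strong induction. The root fits the pattern: \<open>1 / 3\<close> is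
  what the formula for a last child gives at \<open>s 0 = 0\<close>.

  No denominator vanishes, because \<open>a, b > 0\<close> and \<open>b \<le> (6 c + 3) a\<close> propagate down the tree
  (\<open>positive_node\<close>). The last inequality says \<open>s n \<ge> 1 / (3 (1 + 2 v\<^sub>5(n)))\<close>, which is what
  \<open>s (n - 1) \<ge> 0\<close> becomes under the recurrence.
\<close>

section \<open>Children up to a common factor\<close>

text \<open>
  This is the rule for \<open>\<not> 3 dvd b\<close>, taken for all \<open>b\<close>. When \<open>3 dvd b\<close>, the tree merely removes a
  factor 3 from the first, third and fifth child, so that one computation treats both cases.
\<close>

fun unreduced_child :: "nat \<Rightarrow> int \<times> int \<times> int \<Rightarrow> int \<times> int \<times> int" where
  "unreduced_child i (a, b, c) =
    (if i = 0 then (3 * (4*c + 3) * a - 2*b, 3 * (6*c + 5) * a - 3*b, 0)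
     else if i = 1 then ((6*c + 5) * a - b, 6 * (c + 1) * a - b, 0)
     else if i = 2 then (6 * (c + 1) * a - b, 3*a, 0)
     else if i = 3 then (a, 3*a + b, c + 1)
     else (3*a + b, 6*a + 3*b, 0))"

lemma unreduced_child_eq_scaled_child:
  "\<exists>k > 0. unreduced_child i N =
    (k * fst (child i N), k * fst (snd (child i N)), snd (snd (child i N)))"
proof -
  obtain a b c where N: "N = (a, b, c)" by (cases N)
  show ?thesis
  proof (cases "3 dvd b \<and> i \<noteq> 1 \<and> i \<noteq> 3")
    case True
    then obtain d where "b = 3 * d" by (auto elim: dvdE)
    with True show ?thesis
      unfolding N by (intro exI[of _ 3]) (auto simp: algebra_simps)
  next
    case False
    then show ?thesis
      unfolding N by (intro exI[of _ 1]) auto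
  qed
qed

section \<open>Positivity\<close>

text \<open>
  Positivity of \<open>a\<close> and \<open>b\<close> alone is not inherited: the second label of the first child is positive
  only if \<open>b < (6 c + 5) a\<close>. The slightly stronger \<open>b \<le> (6 c + 3) a\<close> does pass to all five children.
\<close>

definition positive_triple :: "int \<times> int \<times> int \<Rightarrow> bool" where
  "positive_triple N \<longleftrightarrow>
    (case N of (a, b, c) \<Rightarrow> 0 < a \<and> 0 < b \<and> 0 \<le> c \<and> b \<le> (6 * c + 3) * a)"

lemma positive_unreduced_child:
  assumes "positive_triple N"
  shows "positive_triple (unreduced_child i N)"
proof -
  obtain a b c where N: "N = (a, b, c)" by (cases N)
  have "0 < a" "0 < b" "0 \<le> c" "b \<le> 6 * (c * a) + 3 * a" "0 \<le> c * a"
    using assms by (auto simp: N positive_triple_def algebra_simps)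
  then show ?thesis
    by (auto simp: N positive_triple_def algebra_simps)
qed

lemma positive_child:
  assumes "positive_triple N"
  shows "positive_triple (child i N)"
proof -
  obtain a' b' c' where child: "child i N = (a', b', c')" by (cases "child i N")
  obtain k where k: "0 < k" and scaled: "unreduced_child i N = (k * a', k * b', c')"
    using unreduced_child_eq_scaled_child[of i N] by (auto simp: child)
  have "0 < k * a'" "0 < k * b'" "0 \<le> c'" "k * b' \<le> k * ((6 * c' + 3) * a')"
    using positive_unreduced_child[OF assms, of i]
    by (auto simp: scaled positive_triple_def algebra_simps)
  with k show ?thesis
    by (simp add: child positive_triple_def zero_less_mult_iff)
qed

lemma positive_node: "positive_triple (node n)"
proof (induction n rule: less_induct)
  case (less n)
  show ?case
  proof (cases "n \<le> 1")
    case True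
    then show ?thesis by (simp add: node.simps positive_triple_def)
  next
    case False
    then have "positive_triple (node ((n + 3) div 5))" by (intro less.IH) auto
    from positive_child[OF this] False show ?thesis by (subst node.simps) simp
  qed
qed

section \<open>The third label is the valuation\<close>

lemma multiplicity_eq_0_child:
  fixes m :: nat
  assumes "m \<ge> 1" "i \<le> 4" "i \<noteq> 3"
  shows "multiplicity 5 (5 * m - 3 + i) = 0"
  using assms by (intro not_dvd_imp_multiplicity_0) presburger

lemma multiplicity_5_times:
  fixes m :: nat
  assumes "m \<ge> 1"
  shows "multiplicity 5 (5 * m) = Suc (multiplicity 5 m)"
  using assms by (intro multiplicity_times_same) auto

lemma vertex_index_cases:
  fixes n :: nat
  assumes "n \<ge> 1"
  obtains "n = 1" | m i where "m \<ge> 1" "i \<le> 4" "m < n" "n = 5 * m - 3 + i"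
proof (cases "n = 1")
  case False
  show ?thesis
  proof (rule that(2))
    show "(n + 3) div 5 \<ge> 1" "(n + 3) mod 5 \<le> 4" "(n + 3) div 5 < n"
      "n = 5 * ((n + 3) div 5) - 3 + (n + 3) mod 5"
      using assms False by presburger+
  qed
qed

lemma third_label_eq_multiplicity:
  assumes "n \<ge> 1"
  shows "snd (snd (node n)) = int (multiplicity 5 n)"
  using assms
proof (induction n rule: less_induct)
  case (less n)
  from less.prems show ?case
  proof (cases rule: vertex_index_cases)
    case 1
    then show ?thesis by (simp add: node.simps)
  next
    case (2 m i)
    obtain a b c where N: "node m = (a, b, c)" by (cases "node m")
    have c: "c = int (multiplicity 5 m)" using less.IH[of m] 2 N by simp
    have label: "snd (snd (node n)) = (if i = 3 then c + 1 else 0)"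
      unfolding \<open>n = 5 * m - 3 + i\<close> node_child[OF \<open>m \<ge> 1\<close> \<open>i \<le> 4\<close>] by (simp add: N)
    show ?thesis
    proof (cases "i = 3")
      case True
      with 2 have "n = 5 * m" by simp
      with 2 True label c show ?thesis by (simp add: multiplicity_5_times)
    next
      case False
      with 2 have "multiplicity 5 n = 0" by (metis multiplicity_eq_0_child)
      with False label show ?thesis by simp
    qed
  qed
qed

lemma s_lower_bound:
  assumes "n \<ge> 1"
  shows "0 < s n" and "1 \<le> (6 * of_nat (multiplicity 5 n) + 3) * s n"
proof -
  obtain a b c where N: "node n = (a, b, c)" by (cases "node n")
  have s: "s n = of_int a / of_int b"
    using assms by (simp add: s_def node_a_def node_b_def N)
  have c: "c = int (multiplicity 5 n)"
    using third_label_eq_multiplicity[OF assms] by (simp add: N)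
  have ab: "0 < a" "0 < b" "b \<le> (6 * c + 3) * a"
    using positive_node[of n] by (auto simp: N positive_triple_def)
  then show "0 < s n" by (simp add: s)
  have "(of_int b :: rat) \<le> of_int ((6 * c + 3) * a)" using ab(3) by (simp only: of_int_le_iff)
  then show "1 \<le> (6 * of_nat (multiplicity 5 n) + 3) * s n"
    using ab by (simp add: s c field_simps)
qed

section \<open>Ratios of the children\<close>

lemma s_child:
  assumes "m \<ge> 1"
  defines "t \<equiv> s m" and "c \<equiv> of_nat (multiplicity 5 m) :: rat"
  shows "s (5 * m - 3) = (3 * (4*c + 3) * t - 2) / (3 * ((6*c + 5) * t - 1))"
    and "s (5 * m - 2) = ((6*c + 5) * t - 1) / (6 * (c + 1) * t - 1)"
    and "s (5 * m - 1) = (6 * (c + 1) * t - 1) / (3 * t)"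
    and "s (5 * m) = t / (3 * t + 1)"
    and "s (5 * m + 1) = (3 * t + 1) / (6 * t + 3)"
proof -
  obtain a b c' where N: "node m = (a, b, c')" by (cases "node m")
  have c': "c = of_int c'"
    using third_label_eq_multiplicity[OF assms(1)] by (simp add: N c_def)
  have b: "(of_int b :: rat) \<noteq> 0"
    using positive_node[of m] by (auto simp: N positive_triple_def)
  have "s m = of_int a / of_int b"
    using assms(1) by (simp add: s_def node_a_def node_b_def N)
  then have a: "of_int a = t * of_int b" using b by (simp add: t_def)
  have ratio: "s (5 * m - 3 + i) =
      of_int (fst (unreduced_child i (a, b, c'))) / of_int (fst (snd (unreduced_child i (a, b, c'))))"
    if "i \<le> 4" for i
  proof -
    have "s (5 * m - 3 + i) = of_int (fst (child i (node m))) / of_int (fst (snd (child i (node m))))"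
      unfolding s_def node_a_def node_b_def node_child[OF assms(1) that] using assms(1) by simp
    then show ?thesis
      using unreduced_child_eq_scaled_child[of i "(a, b, c')"]
      by (auto simp: N simp del: child.simps unreduced_child.simps)
  qed
  have cancel: "x / y = p / q" if "x = p * of_int b" "y = q * of_int b" for x y p q :: rat
    using that b by simp
  have index: "5 * m - 3 + 1 = 5 * m - 2" "5 * m - 3 + 2 = 5 * m - 1"
    "5 * m - 3 + 3 = 5 * m" "5 * m - 3 + 4 = 5 * m + 1"
    using assms(1) by simp_all
  show "s (5 * m - 3) = (3 * (4*c + 3) * t - 2) / (3 * ((6*c + 5) * t - 1))"
    using ratio[of 0] by (auto simp: a c' algebra_simps intro!: cancel)
  show "s (5 * m - 2) = ((6*c + 5) * t - 1) / (6 * (c + 1) * t - 1)"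
    using ratio[of 1] unfolding index by (auto simp: a c' algebra_simps intro!: cancel)
  show "s (5 * m - 1) = (6 * (c + 1) * t - 1) / (3 * t)"
    using ratio[of 2] unfolding index by (auto simp: a c' algebra_simps intro!: cancel)
  show "s (5 * m) = t / (3 * t + 1)"
    using ratio[of 3] unfolding index by (auto simp: a c' algebra_simps intro!: cancel)
  show "s (5 * m + 1) = (3 * t + 1) / (6 * t + 3)"
    using ratio[of 4] unfolding index by (auto simp: a c' algebra_simps intro!: cancel)
qed

text \<open>
  The vertex before the first child of \<open>m + 1\<close> is \<open>5m + 1\<close>, and for \<open>m = 0\<close> this is the root, which
  behaves as the last child of a virtual vertex 0 of ratio 0.
\<close>

lemma s_last_child: "s (5 * m + 1) = (3 * s m + 1) / (6 * s m + 3)"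
proof (cases "m = 0")
  case True
  then show ?thesis by (simp add: s_def node_a_def node_b_def node.simps)
next
  case False
  then show ?thesis by (intro s_child(5)) simp
qed

section \<open>The recurrence\<close>

lemma s_recurrence:
  assumes "n \<ge> 1"
  shows "s n * (3 * (1 + 2 * of_nat (multiplicity 5 n) - s (n - 1))) = 1"
  using assms
proof (induction n rule: less_induct)
  case (less n)
  from less.prems show ?case
  proof (cases rule: vertex_index_cases)
    case 1
    then show ?thesis by (simp add: s_def node_a_def node_b_def node.simps)
  next
    case (2 m i)
    define t where "t = s m"
    define c :: rat where "c = of_nat (multiplicity 5 m)"
    note child = s_child[OF \<open>m \<ge> 1\<close>, folded t_def c_def]
    have t: "0 < t" "1 \<le> (6 * c + 3) * t"
      using s_lower_bound[OF \<open>m \<ge> 1\<close>] by (simp_all add: t_def c_def)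
    have pos: "0 < (6*c + 5) * t - 1" "0 < 6 * (c + 1) * t - 1"
      using t by (simp_all add: algebra_simps)
    have valuation: "multiplicity 5 n = 0" if "i \<noteq> 3"
      using 2 that by (metis multiplicity_eq_0_child)
    consider "i = 0" | "i = 1" | "i = 2" | "i = 3" | "i = 4" using \<open>i \<le> 4\<close> by linarith
    then show ?thesis
    proof cases
      case 1
      define u where "u = s (m - 1)"
      have u: "0 \<le> u"
      proof (cases "m = 1")
        case False
        with \<open>m \<ge> 1\<close> have "m - 1 \<ge> 1" by linarith
        from s_lower_bound(1)[OF this] show ?thesis by (simp add: u_def)
      qed (simp add: u_def s_def)
      have IH: "t * (3 * (1 + 2 * c - u)) = 1"
        using less.IH[of m] 2 by (simp add: t_def c_def u_def)
      have "n = 5 * m - 3" "n - 1 = 5 * (m - 1) + 1" using 1 2 by simp_all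
      moreover have "multiplicity 5 n = 0" using 1 valuation by simp
      moreover have "s (5 * (m - 1) + 1) = (3 * u + 1) / (6 * u + 3)"
        unfolding u_def by (rule s_last_child)
      moreover have "s (5 * m - 3) = (2 * u + 1) / (3 * u + 2)"
      proof -
        \<comment> \<open>The induction hypothesis in the form \<open>6 c t = 1 - 3 t + 3 t u\<close> eliminates \<open>c\<close>; numerator
          and denominator then share the factor \<open>3 t\<close>.\<close>
        have "3 * (4*c + 3) * t - 2 = (3 * t) * (2 * u + 1)"
          "3 * ((6*c + 5) * t - 1) = (3 * t) * (3 * u + 2)"
          using IH by (simp_all add: algebra_simps)
        then show ?thesis using t(1) unfolding child(1) by simp
      qed
      ultimately show ?thesis
        using u by (simp only:) (simp add: divide_simps, simp add: algebra_simps)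
    next
      case i: 2
      have "n = 5 * m - 2" "n - 1 = 5 * m - 3" using i 2 by simp_all
      moreover have "multiplicity 5 n = 0" using i valuation by simp
      ultimately show ?thesis using pos by (simp only: child) (simp add: divide_simps, simp add: algebra_simps)
    next
      case i: 3
      have "n = 5 * m - 1" "n - 1 = 5 * m - 2" using i 2 by simp_all
      moreover have "multiplicity 5 n = 0" using i valuation by simp
      ultimately show ?thesis using pos t by (simp only: child) (simp add: divide_simps, simp add: algebra_simps)
    next
      case i: 4
      have "n = 5 * m" "n - 1 = 5 * m - 1" using i 2 by simp_all
      moreover have "of_nat (multiplicity 5 n) = c + 1"
        using \<open>n = 5 * m\<close> 2 by (simp add: multiplicity_5_times c_def)
      ultimately show ?thesis using t by (simp only: child) (simp add: divide_simps, simp add: algebra_simps)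
    next
      case i: 5
      have "n = 5 * m + 1" "n - 1 = 5 * m" using i 2 by simp_all
      moreover have "multiplicity 5 n = 0" using i valuation by simp
      ultimately show ?thesis using t by (simp only: child) (simp add: divide_simps)
    qed
  qed
qed

theorem proposition3:
  fixes n :: nat
  assumes "n \<ge> 1"
  shows "node_b n \<noteq> 0 \<and>
    3 * (1 + 2 * of_nat (multiplicity 5 n) - s (n - 1)) \<noteq> 0 \<and>
    s n = 1 / (3 * (1 + 2 * of_nat (multiplicity 5 n) - s (n - 1)))"
proof (intro conjI)
  show "node_b n \<noteq> 0"
    using positive_node[of n] by (auto simp: node_b_def positive_triple_def)
  show nonzero: "3 * (1 + 2 * of_nat (multiplicity 5 n) - s (n - 1)) \<noteq> 0"
  proof
    assume "3 * (1 + 2 * of_nat (multiplicity 5 n) - s (n - 1)) = 0"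
    with s_recurrence[OF assms] show False by simp
  qed
  show "s n = 1 / (3 * (1 + 2 * of_nat (multiplicity 5 n) - s (n - 1)))"
    using nonzero s_recurrence[OF assms] by (metis nonzero_eq_divide_eq)
qed

end
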